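(* In the linear oblivious setting, consider the strategy that at each round queries the label independently with probability $\mu\in(0,1]$ and predicts $\hat y_t=\mathrm{clip}(\langle\hat\theta_t,x_t\rangle)$ with $\hat\theta_t=\arg\min_\theta\sum_{i<t,\,q_i=1}(\langle\theta,x_i\rangle-y_i)^2+C^{-2}\|\theta\|_2^2$. Then $\mathbb{E}[Q]=\mu T$ and $\mathbb{E}[R]=\tilde O(\tilde\eta^2d/\mu)$.
   Context: Linear oblivious setting: $d,T\ge1$, $C>0$, $\eta\ge0$, $\tilde\eta=\max\{1,\eta\}$; $\theta^*\in\mathbb{R}^d$ with $\|\theta^*\|_2\le C$ and $x_1,\dots,x_T$ with $\|x_t\|_2\le1$, $|\langle\theta^*,x_t\rangle|\le1$ fixed in advance; $y_t=\langle\theta^*,x_t\rangle+\xi_t$ with $\xi_t$ independent zero-mean sub-Gaussian with variance proxy $\eta^2$. $Q=\sum_tq_t$, $R=\sum_t(\hat y_t-\langle\theta^*,x_t\rangle)^2$, $\mathrm{clip}(z)=\min(1,\max(-1,z))$. $\tilde O$ hides absolute constants and factors polylogarithmic in $T$ and $C$. *)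

theory Defs
  imports "HOL-Probability.Probability"
begin

text \<open>Vectors of R^d are represented as functions nat => real vanishing outside {0..<d}.\<close>

definition Vd :: "nat \<Rightarrow> (nat \<Rightarrow> real) set" where
  "Vd d = {v. \<forall>i\<ge>d. v i = 0}"

definition ip :: "nat \<Rightarrow> (nat \<Rightarrow> real) \<Rightarrow> (nat \<Rightarrow> real) \<Rightarrow> real" where
  "ip d u v = (\<Sum>i<d. u i * v i)"

definition clip :: "real \<Rightarrow> real" where
  "clip z = min 1 (max (-1) z)"

definition ridge_obj :: "nat \<Rightarrow> real \<Rightarrow> (nat \<Rightarrow> nat \<Rightarrow> real) \<Rightarrow> (nat \<Rightarrow> real)
    \<Rightarrow> (nat \<Rightarrow> bool) \<Rightarrow> nat \<Rightarrow> (nat \<Rightarrow> real) \<Rightarrow> real" where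
  "ridge_obj d C x y q t \<theta> =
     (\<Sum>i<t. if q i then (ip d \<theta> (x i) - y i)\<^sup>2 else 0) + ip d \<theta> \<theta> / C\<^sup>2"

definition theta_hat :: "nat \<Rightarrow> real \<Rightarrow> (nat \<Rightarrow> nat \<Rightarrow> real) \<Rightarrow> (nat \<Rightarrow> real)
    \<Rightarrow> (nat \<Rightarrow> bool) \<Rightarrow> nat \<Rightarrow> (nat \<Rightarrow> real)" where
  "theta_hat d C x y q t =
     (THE \<theta>. \<theta> \<in> Vd d \<and> (\<forall>\<theta>'\<in>Vd d. ridge_obj d C x y q t \<theta> \<le> ridge_obj d C x y q t \<theta>'))"

text \<open>An outcome \<omega> t = (q_t, \<xi>_t): query bit and noise of round t.\<close>
definition labels :: "nat \<Rightarrow> (nat \<Rightarrow> real) \<Rightarrow> (nat \<Rightarrow> nat \<Rightarrow> real) \<Rightarrow> (nat \<Rightarrow> bool \<times> real) \<Rightarrow> nat \<Rightarrow> real" where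
  "labels d \<theta>s x \<omega> t = ip d \<theta>s (x t) + snd (\<omega> t)"

definition prediction :: "nat \<Rightarrow> real \<Rightarrow> (nat \<Rightarrow> real) \<Rightarrow> (nat \<Rightarrow> nat \<Rightarrow> real)
    \<Rightarrow> (nat \<Rightarrow> bool \<times> real) \<Rightarrow> nat \<Rightarrow> real" where
  "prediction d C \<theta>s x \<omega> t =
     clip (ip d (theta_hat d C x (labels d \<theta>s x \<omega>) (\<lambda>i. fst (\<omega> i)) t) (x t))"

definition num_queries :: "nat \<Rightarrow> (nat \<Rightarrow> bool \<times> real) \<Rightarrow> real" where
  "num_queries T \<omega> = (\<Sum>t<T. if fst (\<omega> t) then 1 else 0)"

definition regret :: "nat \<Rightarrow> nat \<Rightarrow> real \<Rightarrow> (nat \<Rightarrow> real) \<Rightarrow> (nat \<Rightarrow> nat \<Rightarrow> real)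
    \<Rightarrow> (nat \<Rightarrow> bool \<times> real) \<Rightarrow> real" where
  "regret d T C \<theta>s x \<omega> = (\<Sum>t<T. (prediction d C \<theta>s x \<omega> t - ip d \<theta>s (x t))\<^sup>2)"

definition subgaussian :: "real measure \<Rightarrow> real \<Rightarrow> bool" where
  "subgaussian N \<eta> \<longleftrightarrow> prob_space N \<and> sets N = sets borel \<and>
     integrable N (\<lambda>z. z) \<and> (\<integral>z. z \<partial>N) = 0 \<and>
     (\<forall>l::real. integrable N (\<lambda>z. exp (l * z)) \<and>
        (\<integral>z. exp (l * z) \<partial>N) \<le> exp (l\<^sup>2 * \<eta>\<^sup>2 / 2))"

definition outcome_space :: "nat \<Rightarrow> real \<Rightarrow> (nat \<Rightarrow> real measure) \<Rightarrow> (nat \<Rightarrow> bool \<times> real) measure" where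
  "outcome_space T \<mu> N = PiM {..<T} (\<lambda>t. measure_pmf (bernoulli_pmf \<mu>) \<Otimes>\<^sub>M N t)"

end

theory Submission
  imports Defs "Jordan_Normal_Form.Determinant"
begin

text \<open>
  The prediction of round t depends only on earlier rounds, so it is independent of the query bit
  of round t, and \<mu> times the expected regret equals the expected squared error summed over the
  queried rounds only. Condition on the query pattern q (there are finitely many) and write z_s
  for x_s if round s is queried and for 0 otherwise, V for the regularised Gram matrix
  \<open>C\<^sup>-\<^sup>2 I + \<Sum> z_s z_s\<^sup>T\<close> over s < t, and w_t for the leverage
  \<open>x_t\<^sup>T V\<^sup>-\<^sup>1 x_t\<close>. The noise is then centred and independent with variance
  at most \<open>8 max(1, \<eta>)\<^sup>2\<close>, so the bias-variance decomposition of the ridge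
  estimator bounds the expected error of round t by \<open>8 max(1, \<eta>)\<^sup>2 min(1, w_t)\<close>.
  On queried rounds det V is multiplied by 1 + w_t, hence \<open>\<Sum> min(1, w_t)\<close> is at most
  twice the logarithm of the growth of det V. Since the regret is at most 4T, only the case
  \<open>d \<le> T\<close> matters, and there the crude Leibniz bound \<open>d! (C\<^sup>-\<^sup>2 + T)\<^sup>d\<close>
  on the determinant already gives \<open>O(d log (T (1 + C)))\<close>.
\<close>

section \<open>The regularised Gram operator and its inverse\<close>

definition mv :: "nat \<Rightarrow> (nat \<Rightarrow> nat \<Rightarrow> real) \<Rightarrow> (nat \<Rightarrow> real) \<Rightarrow> nat \<Rightarrow> real" where
  "mv d A v i = (\<Sum>j<d. A i j * v j)"

text \<open>\<open>gram d c z t\<close> is the operator \<open>c I + \<Sum> z_s z_s\<^sup>T\<close> over s < t; the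
  recursion for \<open>gram_inv\<close> is the Sherman-Morrison formula.\<close>

definition gram :: "nat \<Rightarrow> real \<Rightarrow> (nat \<Rightarrow> nat \<Rightarrow> real) \<Rightarrow> nat \<Rightarrow> (nat \<Rightarrow> real) \<Rightarrow> nat \<Rightarrow> real" where
  "gram d c z t a i = c * a i + (\<Sum>s<t. ip d (z s) a * z s i)"

primrec gram_inv :: "nat \<Rightarrow> real \<Rightarrow> (nat \<Rightarrow> nat \<Rightarrow> real) \<Rightarrow> nat \<Rightarrow> nat \<Rightarrow> nat \<Rightarrow> real" where
  "gram_inv d c z 0 = (\<lambda>i j. if i = j then 1 / c else 0)"
| "gram_inv d c z (Suc t) = (\<lambda>i j. gram_inv d c z t i j
     - mv d (gram_inv d c z t) (z t) i * mv d (gram_inv d c z t) (z t) j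
       / (1 + ip d (z t) (mv d (gram_inv d c z t) (z t))))"

abbreviation leverage :: "nat \<Rightarrow> real \<Rightarrow> (nat \<Rightarrow> nat \<Rightarrow> real) \<Rightarrow> nat \<Rightarrow> (nat \<Rightarrow> real) \<Rightarrow> real" where
  "leverage d c z t v \<equiv> ip d v (mv d (gram_inv d c z t) v)"

section \<open>Bilinearity and Cauchy-Schwarz for \<open>ip\<close>\<close>

lemma ip_commute: "ip d u v = ip d v u"
  by (simp add: ip_def mult.commute)

lemma ip_add_right: "ip d u (\<lambda>i. v i + w i) = ip d u v + ip d u w"
  by (simp add: ip_def algebra_simps sum.distrib)

lemma ip_diff_right: "ip d u (\<lambda>i. v i - w i) = ip d u v - ip d u w"
  by (simp add: ip_def algebra_simps sum_subtractf)

lemma ip_scale_right: "ip d u (\<lambda>i. k * v i) = k * ip d u v"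
  by (simp add: ip_def algebra_simps sum_distrib_left)

lemma ip_sum_right: "ip d u (\<lambda>i. \<Sum>s\<in>S. f s i) = (\<Sum>s\<in>S. ip d u (f s))"
  unfolding ip_def sum_distrib_left by (rule sum.swap)

lemmas ip_linear_right = ip_add_right ip_diff_right ip_scale_right ip_sum_right

lemma ip_self_nonneg: "ip d u u \<ge> 0"
  by (simp add: ip_def sum_nonneg)

lemma ip_cong: "(\<And>i. i < d \<Longrightarrow> u i = u' i) \<Longrightarrow> (\<And>i. i < d \<Longrightarrow> v i = v' i) \<Longrightarrow> ip d u v = ip d u' v'"
  unfolding ip_def by (rule sum.cong) auto

lemma ip_Cauchy_Schwarz: "(ip d u v)\<^sup>2 \<le> ip d u u * ip d v v"
  unfolding ip_def using Cauchy_Schwarz_ineq_sum[of u v "{..<d}"] by (simp add: power2_eq_square)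

section \<open>Self-adjointness and the Sherman-Morrison inverse\<close>

lemma gram_inv_sym: "gram_inv d c z t i j = gram_inv d c z t j i"
  by (induction t arbitrary: i j) (auto simp: mult.commute)

lemma ip_gram_inv_self_adjoint:
  "ip d u (mv d (gram_inv d c z t) v) = ip d (mv d (gram_inv d c z t) u) v"
proof -
  have "ip d u (mv d (gram_inv d c z t) v) = (\<Sum>i<d. \<Sum>j<d. u i * (gram_inv d c z t i j * v j))"
    by (simp add: ip_def mv_def sum_distrib_left)
  also have "\<dots> = (\<Sum>j<d. \<Sum>i<d. u i * (gram_inv d c z t i j * v j))"
    by (rule sum.swap)
  also have "\<dots> = ip d (mv d (gram_inv d c z t) u) v"
    unfolding ip_def mv_def sum_distrib_right
    by (intro sum.cong refl, subst gram_inv_sym) (simp add: mult_ac)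
  finally show ?thesis .
qed

lemma ip_gram_self_adjoint: "ip d u (gram d c z t v) = ip d (gram d c z t u) v"
  by (subst (2) ip_commute, simp add: gram_def[abs_def] ip_linear_right)
     (simp add: ip_commute mult_ac ip_scale_right)

lemma ip_gram_self: "ip d a (gram d c z t a) = c * ip d a a + (\<Sum>s<t. (ip d (z s) a)\<^sup>2)"
  by (simp add: gram_def[abs_def] ip_linear_right power2_eq_square)
     (simp add: ip_commute ip_scale_right mult_ac)

lemma gram_Suc: "gram d c z (Suc t) a i = gram d c z t a i + ip d (z t) a * z t i"
  by (simp add: gram_def)

lemma gram_diff_scale:
  "gram d c z t (\<lambda>i. a i - k * b i) i = gram d c z t a i - k * gram d c z t b i"
  by (simp add: gram_def ip_linear_right algebra_simps sum_subtractf sum_distrib_left)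

text \<open>The two claims need each other, hence the joint induction: the Sherman-Morrison update
  divides by \<open>1 + w\<close> and so needs the earlier leverage nonnegative, while nonnegativity
  at the next stage comes from the inverse identity just proved there. The identity is confined to
  coordinates below \<open>d\<close>, the only ones that \<open>ip\<close> and \<open>mv\<close> sum
  over.\<close>

lemma gram_gram_inv_and_nonneg:
  assumes c: "c > 0"
  shows "(\<forall>v. \<forall>i<d. gram d c z t (mv d (gram_inv d c z t) v) i = v i) \<and> (\<forall>v. 0 \<le> leverage d c z t v)"
proof (induction t)
  case 0
  have "mv d (gram_inv d c z 0) v i = v i / c" if "i < d" for v i
    using that by (simp add: mv_def if_distrib[of "\<lambda>x. x * _"] sum.delta' cong: if_cong)
  then show ?case using c
    by (auto simp: gram_def ip_def intro!: sum_nonneg)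
next
  case (Suc t)
  let ?P = "gram_inv d c z t"
  define g where "g = mv d ?P (z t)"
  define w where "w = ip d (z t) g"
  have w: "w \<ge> 0" using Suc by (simp add: w_def g_def)
  have G: "gram d c z t (mv d ?P v) i = v i" if "i < d" for v i using Suc that by blast
  have inv: "gram d c z (Suc t) (mv d (gram_inv d c z (Suc t)) v) i = v i" if i: "i < d" for v i
  proof -
    \<comment> \<open>The updated inverse sends \<open>v\<close> to its old image minus
      \<open>k\<close> times \<open>g\<close>.\<close>
    define k where "k = ip d g v / (1 + w)"
    have mv: "mv d (gram_inv d c z (Suc t)) v = (\<lambda>i. mv d ?P v i - k * g i)"
      by (rule ext, simp add: mv_def[of _ "gram_inv _ _ _ (Suc _)"] flip: g_def w_def)
        (simp add: mv_def k_def ip_def sum_subtractf algebra_simps sum_distrib_left sum_divide_distrib)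
    have zv: "ip d (z t) (mv d ?P v) = ip d g v"
      by (simp add: g_def ip_gram_inv_self_adjoint)
    have "gram d c z (Suc t) (mv d (gram_inv d c z (Suc t)) v) i
        = v i - k * z t i + (ip d g v - k * w) * z t i"
      using G[OF i, of v] G[OF i, of "z t"]
      by (simp only: mv gram_Suc gram_diff_scale ip_linear_right zv w_def flip: g_def)
        (simp add: algebra_simps)
    \<comment> \<open>All multiples of \<open>z t\<close> are collected; the choice of
      \<open>k\<close> makes their coefficient vanish.\<close>
    also have "\<dots> = v i + (ip d g v - k * (1 + w)) * z t i" by (simp add: algebra_simps)
    also have "ip d g v - k * (1 + w) = 0" using w by (simp add: k_def)
    finally show ?thesis by simp
  qed
  have "leverage d c z (Suc t) v \<ge> 0" for v
  proof -
    let ?a = "mv d (gram_inv d c z (Suc t)) v"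
    \<comment> \<open>By \<open>inv\<close>, \<open>v\<close> is the Gram operator applied to
      \<open>?a\<close>, so the leverage is a sum of squares.\<close>
    have "leverage d c z (Suc t) v = ip d (gram d c z (Suc t) ?a) ?a"
      by (rule ip_cong) (auto simp: inv simp del: gram_inv.simps)
    also have "\<dots> = c * ip d ?a ?a + (\<Sum>s<Suc t. (ip d (z s) ?a)\<^sup>2)"
      by (metis ip_gram_self ip_commute)
    also have "\<dots> \<ge> 0" using c by (intro add_nonneg_nonneg mult_nonneg_nonneg sum_nonneg ip_self_nonneg) auto
    finally show ?thesis .
  qed
  with inv show ?case by blast
qed

lemma gram_gram_inv:
  "c > 0 \<Longrightarrow> i < d \<Longrightarrow> gram d c z t (mv d (gram_inv d c z t) v) i = v i"
  using gram_gram_inv_and_nonneg by blast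

lemma leverage_nonneg: "c > 0 \<Longrightarrow> 0 \<le> leverage d c z t v"
  using gram_gram_inv_and_nonneg by blast

text \<open>The first summand will dominate the squared shrinkage bias of the ridge estimator, and
  the second is the sum of the squared noise coefficients.\<close>

lemma leverage_eq:
  assumes "c > 0" and a: "a = mv d (gram_inv d c z t) v"
  shows "leverage d c z t v = c * ip d a a + (\<Sum>s<t. (ip d (z s) a)\<^sup>2)"
proof -
  have "leverage d c z t v = ip d (gram d c z t a) a"
    unfolding a by (rule ip_cong) (auto simp: gram_gram_inv assms(1))
  then show ?thesis by (metis ip_gram_self ip_commute)
qed

section \<open>Determinants and the elliptic potential\<close>

text \<open>The matrix determinant lemma. The block matrix \<open>?M\<close> is reduced to block
  upper triangular form in two ways by unit block lower triangular factors; comparing determinants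
  needs no division, so an integral domain suffices.\<close>

lemma det_one_plus_rank_one:
  fixes U V :: "'a :: idom mat"
  assumes U: "U \<in> carrier_mat n 1" and V: "V \<in> carrier_mat 1 n"
  shows "Determinant.det (1\<^sub>m n + U * V) = 1 + (V * U) $$ (0,0)"
proof -
  let ?M = "four_block_mat (1\<^sub>m n) U (- V) (1\<^sub>m 1)"
  let ?N = "four_block_mat (1\<^sub>m n + U * V) U (0\<^sub>m 1 n) (1\<^sub>m 1)"
  let ?L' = "four_block_mat (1\<^sub>m n) (0\<^sub>m n 1) (- V) (1\<^sub>m 1)"
  let ?L = "four_block_mat (1\<^sub>m n) (0\<^sub>m n 1) V (1\<^sub>m 1)"
  have car: "?M \<in> carrier_mat (n+1) (n+1)" "?N \<in> carrier_mat (n+1) (n+1)"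
    "?L' \<in> carrier_mat (n+1) (n+1)" "?L \<in> carrier_mat (n+1) (n+1)"
    by (rule four_block_carrier_mat; use U V in simp)+
  have "?N * ?L' = ?M"
    by (subst mult_four_block_mat[of _ n n _ 1 _ 1 _ _ n _ 1])
       (insert U V, auto intro!: cong_four_block_mat eq_matI)
  then have "Determinant.det ?M = Determinant.det ?N * Determinant.det ?L'"
    using det_mult[OF car(2,3)] by simp
  also have "Determinant.det ?N = Determinant.det (1\<^sub>m n + U * V)"
    using det_four_block_mat_lower_left_zero[of "1\<^sub>m n + U * V" n U 1 "0\<^sub>m 1 n" "1\<^sub>m 1"] U V by simp
  also have "Determinant.det ?L' = 1"
    using det_four_block_mat_upper_right_zero[of "1\<^sub>m n :: 'a mat" n "0\<^sub>m n 1" 1 "-V" "1\<^sub>m 1"] V by simp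
  finally have M: "Determinant.det ?M = Determinant.det (1\<^sub>m n + U * V)" by simp
  have "?L * ?M = four_block_mat (1\<^sub>m n) U (0\<^sub>m 1 n) (V * U + 1\<^sub>m 1)"
    by (subst mult_four_block_mat[of _ n n _ 1 _ 1 _ _ n _ 1])
       (insert U V, auto intro!: cong_four_block_mat eq_matI)
  then have "Determinant.det ?L * Determinant.det ?M
      = Determinant.det (four_block_mat (1\<^sub>m n) U (0\<^sub>m 1 n) (V * U + 1\<^sub>m 1))"
    using det_mult[OF car(4,1)] by simp
  also have "Determinant.det ?L = 1"
    using det_four_block_mat_upper_right_zero[of "1\<^sub>m n :: 'a mat" n "0\<^sub>m n 1" 1 V "1\<^sub>m 1"] V by simp
  also have "Determinant.det (four_block_mat (1\<^sub>m n) U (0\<^sub>m 1 n) (V * U + 1\<^sub>m 1))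
      = Determinant.det (V * U + 1\<^sub>m 1)"
    using det_four_block_mat_lower_left_zero[of "1\<^sub>m n" n U 1 "0\<^sub>m 1 n" "V * U + 1\<^sub>m 1"] U V by simp
  also have "\<dots> = 1 + (V * U) $$ (0,0)"
    using U V by (subst det_single) auto
  finally show ?thesis using M by simp
qed

text \<open>The operator \<open>gram\<close> as a matrix, used for determinants only.\<close>

definition gram_mat :: "nat \<Rightarrow> real \<Rightarrow> (nat \<Rightarrow> nat \<Rightarrow> real) \<Rightarrow> nat \<Rightarrow> real mat" where
  "gram_mat d c z t = mat d d (\<lambda>(i,j). (if i = j then c else 0) + (\<Sum>s<t. z s i * z s j))"

lemma gram_mat_carrier: "gram_mat d c z t \<in> carrier_mat d d"
  by (simp add: gram_mat_def)

lemma gram_mat_mult_vec: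
  assumes "i < d"
  shows "(\<Sum>k<d. gram_mat d c z t $$ (i,k) * g k) = gram d c z t g i"
proof -
  have "(\<Sum>k<d. gram_mat d c z t $$ (i,k) * g k)
      = (\<Sum>k<d. (if i = k then c * g k else 0)) + (\<Sum>k<d. \<Sum>s<t. z s i * z s k * g k)"
    using assms unfolding sum.distrib[symmetric]
    by (intro sum.cong) (auto simp: gram_mat_def algebra_simps sum_distrib_left)
  also have "(\<Sum>k<d. \<Sum>s<t. z s i * z s k * g k) = (\<Sum>s<t. \<Sum>k<d. z s i * z s k * g k)"
    by (rule sum.swap)
  finally show ?thesis using assms
    by (simp add: gram_def ip_def sum_distrib_left mult_ac)
qed

text \<open>With \<open>g\<close> the solution of V g = z_t, the rank-one update factors as V + z_t
  z_t^T = V (I + g z_t^T), and the matrix determinant lemma evaluates the second factor.\<close>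

lemma det_gram_mat_Suc:
  assumes c: "c > 0"
  shows "Determinant.det (gram_mat d c z (Suc t))
    = Determinant.det (gram_mat d c z t) * (1 + leverage d c z t (z t))"
proof -
  define g where "g = mv d (gram_inv d c z t) (z t)"
  define U where "U = mat d 1 (\<lambda>(i,_). g i)"
  define V where "V = mat 1 d (\<lambda>(_,j). z t j)"
  have U: "U \<in> carrier_mat d 1" and V: "V \<in> carrier_mat 1 d" by (auto simp: U_def V_def)
  have GU: "gram_mat d c z t * U = mat d 1 (\<lambda>(i,_). z t i)"
  proof (rule eq_matI)
    fix i j assume "i < dim_row (mat d 1 (\<lambda>(i,_). z t i))" "j < dim_col (mat d 1 (\<lambda>(i,_). z t i))"
    then have i: "i < d" and j: "j = 0" by auto
    have "(gram_mat d c z t * U) $$ (i,j) = (\<Sum>k<d. gram_mat d c z t $$ (i,k) * g k)"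
      using i j gram_mat_carrier[of d c z t] U
      by (auto simp: scalar_prod_def U_def lessThan_atLeast0 intro!: sum.cong)
    also have "\<dots> = z t i"
      by (simp add: gram_mat_mult_vec[OF i] g_def gram_gram_inv c i)
    finally show "(gram_mat d c z t * U) $$ (i,j) = mat d 1 (\<lambda>(i,_). z t i) $$ (i,j)" using i j by simp
  qed (use gram_mat_carrier[of d c z t] U in auto)
  have "gram_mat d c z t * (1\<^sub>m d + U * V) = gram_mat d c z t + (gram_mat d c z t * U) * V"
    using mult_add_distrib_mat[OF gram_mat_carrier[of d c z t] one_carrier_mat mult_carrier_mat[OF U V]]
      assoc_mult_mat[OF gram_mat_carrier[of d c z t] U V] right_mult_one_mat[OF gram_mat_carrier[of d c z t]]
    by simp
  also have "\<dots> = gram_mat d c z (Suc t)"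
    unfolding GU by (rule eq_matI) (auto simp: gram_mat_def V_def scalar_prod_def)
  finally have "Determinant.det (gram_mat d c z (Suc t))
      = Determinant.det (gram_mat d c z t) * Determinant.det (1\<^sub>m d + U * V)"
    using det_mult[OF gram_mat_carrier[of d c z t] add_carrier_mat[OF mult_carrier_mat[OF U V]], of "1\<^sub>m d"]
    by simp
  also have "Determinant.det (1\<^sub>m d + U * V) = 1 + (V * U) $$ (0,0)"
    by (rule det_one_plus_rank_one[OF U V])
  also have "(V * U) $$ (0,0) = ip d (z t) g"
    by (simp add: U_def V_def scalar_prod_def ip_def lessThan_atLeast0)
  finally show ?thesis by (simp add: g_def)
qed

lemma det_gram_mat:
  assumes "c > 0"
  shows "Determinant.det (gram_mat d c z t) = c ^ d * (\<Prod>s<t. 1 + leverage d c z s (z s))"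
proof (induction t)
  case 0
  have "gram_mat d c z 0 = c \<cdot>\<^sub>m 1\<^sub>m d"
    by (rule eq_matI) (auto simp: gram_mat_def)
  then show ?case by simp
qed (simp add: det_gram_mat_Suc assms)

section \<open>Upper bounds on the determinant and the potential\<close>

text \<open>The Leibniz expansion has n! terms, each a signed product of n entries.\<close>

lemma abs_det_le_fact:
  fixes A :: "real mat"
  assumes A: "A \<in> carrier_mat n n" and B: "\<And>i j. i < n \<Longrightarrow> j < n \<Longrightarrow> \<bar>A $$ (i,j)\<bar> \<le> B"
  shows "\<bar>Determinant.det A\<bar> \<le> fact n * B ^ n"
proof -
  have "\<bar>Determinant.det A\<bar> \<le> (\<Sum>p | p permutes {0..<n}. \<bar>signof p * (\<Prod>i = 0..<n. A $$ (i, p i))\<bar>)"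
    unfolding det_def'[OF A] by (rule sum_abs)
  also have "\<dots> \<le> (\<Sum>p | p permutes {0..<n}. B ^ n)"
  proof (rule sum_mono)
    fix p assume "p \<in> {p. p permutes {0..<n}}"
    then have p: "p i < n" if "i < n" for i using that permutes_in_image[of p "{0..<n}" i] by auto
    have "\<bar>signof p * (\<Prod>i = 0..<n. A $$ (i, p i))\<bar> = (\<Prod>i = 0..<n. \<bar>A $$ (i, p i)\<bar>)"
      by (simp add: abs_mult abs_prod sign_def)
    also have "\<dots> \<le> (\<Prod>i = 0..<n. B)" by (rule prod_mono) (auto intro!: B p)
    finally show "\<bar>signof p * (\<Prod>i = 0..<n. A $$ (i, p i))\<bar> \<le> B ^ n" by simp
  qed
  also have "\<dots> = fact n * B ^ n" by (simp add: card_permutations[of "{0..<n}" n])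
  finally show ?thesis .
qed

text \<open>The product is the determinant divided by \<open>c ^ d\<close>. Coordinates of a vector
  in the unit ball are at most 1 in absolute value, so every Gram entry is at most
  \<open>c + t\<close>.\<close>

lemma prod_leverage_le:
  assumes c: "c > 0" and z: "\<And>s. s < t \<Longrightarrow> ip d (z s) (z s) \<le> 1"
  shows "(\<Prod>s<t. 1 + leverage d c z s (z s)) \<le> fact d * (1 + real t / c) ^ d"
proof -
  have z1: "\<bar>z s i\<bar> \<le> 1" if "s < t" "i < d" for s i
  proof -
    have "(z s i)\<^sup>2 \<le> ip d (z s) (z s)"
      unfolding ip_def power2_eq_square using that by (intro member_le_sum) auto
    then show ?thesis using z[OF that(1)] by (simp add: abs_le_square_iff[of _ 1, simplified])
  qed
  have "\<bar>gram_mat d c z t $$ (i,j)\<bar> \<le> c + real t" if "i < d" "j < d" for i j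
  proof -
    have "\<bar>\<Sum>s<t. z s i * z s j\<bar> \<le> (\<Sum>s<t. \<bar>z s i * z s j\<bar>)" by (rule sum_abs)
    also have "\<dots> \<le> (\<Sum>s<t. 1)"
      using z1 that by (intro sum_mono) (auto simp: abs_mult intro: mult_le_one)
    finally show ?thesis using that c by (auto simp: gram_mat_def)
  qed
  then have "\<bar>Determinant.det (gram_mat d c z t)\<bar> \<le> fact d * (c + real t) ^ d"
    by (intro abs_det_le_fact gram_mat_carrier)
  then have "c ^ d * (\<Prod>s<t. 1 + leverage d c z s (z s)) \<le> fact d * (c + real t) ^ d"
    using c by (simp add: det_gram_mat)
  also have "(c + real t) ^ d = c ^ d * (1 + real t / c) ^ d"
    using c by (simp add: power_mult_distrib[symmetric] field_simps)
  finally show ?thesis using c by (simp add: mult.left_commute)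
qed

text \<open>The elliptic potential argument: each truncated leverage is at most twice the logarithm
  of its determinant factor, and the logarithms add up. The assumption \<open>d \<le> t\<close>
  absorbs the factorial, since then d! is at most t^d.\<close>

lemma sum_min_leverage_le:
  assumes c: "c > 0" and z: "\<And>s. s < t \<Longrightarrow> ip d (z s) (z s) \<le> 1" and dt: "d \<le> t" and t: "t \<ge> 1"
  shows "(\<Sum>s<t. min 1 (leverage d c z s (z s))) \<le> 2 * real d * (ln (real t) + ln (1 + real t / c))"
proof -
  let ?w = "\<lambda>s. leverage d c z s (z s)"
  have w: "?w s \<ge> 0" for s by (rule leverage_nonneg[OF c])
  have w1: "1 + ?w s > 0" for s using w[of s] by linarith
  \<comment> \<open>The quantity w / (1 + w) lies between: it is at least half of the minimum, and
    at most ln (1 + w) by ln u \<le> u - 1 at u = 1 / (1 + w).\<close>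
  have min_le_ln: "min 1 w \<le> 2 * ln (1 + w)" if "w \<ge> 0" for w :: real
  proof -
    have "min 1 w * (1 + w) \<le> 2 * w"
    proof (cases "w \<le> 1")
      case True
      then show ?thesis using that mult_left_le[of w w] by (simp add: algebra_simps)
    qed (use that in simp)
    then have "min 1 w \<le> 2 * (w / (1 + w))" using that by (simp add: field_simps)
    also have "w / (1 + w) = 1 - 1 / (1 + w)" using that by (simp add: field_simps)
    also have "\<dots> \<le> ln (1 + w)"
      using ln_le_minus_one[of "1 / (1 + w)"] that by (simp add: ln_div)
    finally show ?thesis by simp
  qed
  have "fact d \<le> (real t) ^ d"
  proof -
    have "fact d \<le> real d ^ d" using fact_le_power[of d, where ?'a=real] by simp
    also have "\<dots> \<le> real t ^ d" using dt by (intro power_mono) auto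
    finally show ?thesis .
  qed
  have "(\<Sum>s<t. min 1 (?w s)) \<le> (\<Sum>s<t. 2 * ln (1 + ?w s))"
    by (intro sum_mono min_le_ln w)
  also have "\<dots> = 2 * ln (\<Prod>s<t. 1 + ?w s)"
    using w1 by (subst ln_prod) (auto simp: sum_distrib_left less_le)
  also have "ln (\<Prod>s<t. 1 + ?w s) \<le> ln (real t ^ d * (1 + real t / c) ^ d)"
  proof (rule ln_mono)
    show "0 < (\<Prod>s<t. 1 + ?w s)" using w1 by (intro prod_pos) auto
    have "(\<Prod>s<t. 1 + ?w s) \<le> fact d * (1 + real t / c) ^ d"
      by (rule prod_leverage_le[OF c z])
    also have "\<dots> \<le> real t ^ d * (1 + real t / c) ^ d"
      using c \<open>fact d \<le> _\<close> by (intro mult_right_mono) auto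
    finally show "(\<Prod>s<t. 1 + ?w s) \<le> real t ^ d * (1 + real t / c) ^ d" .
  qed
  also have "\<dots> = real d * (ln (real t) + ln (1 + real t / c))"
    using c t by (subst ln_mult_pos) (auto simp: ln_realpow algebra_simps add_pos_nonneg)
  finally show ?thesis by simp
qed

section \<open>The ridge estimator\<close>

text \<open>Zeroing the unqueried vectors, instead of dropping them, keeps the time index: such
  rounds leave the Gram operator unchanged and have leverage zero.\<close>

definition masked :: "(nat \<Rightarrow> bool) \<Rightarrow> (nat \<Rightarrow> nat \<Rightarrow> real) \<Rightarrow> nat \<Rightarrow> nat \<Rightarrow> real" where
  "masked q x t i = (if q t then x t i else 0)"

lemma ip_masked: "ip d u (masked q x s) = (if q s then ip d u (x s) else 0)"
  by (simp add: ip_def masked_def)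

lemma masked_apply: "masked q x t = (if q t then x t else (\<lambda>_. 0))"
  by (auto simp: masked_def)

text \<open>The closed form of the minimiser, cut off at \<open>d\<close> so that it lies in
  \<open>Vd d\<close>.\<close>

definition ridge :: "nat \<Rightarrow> real \<Rightarrow> (nat \<Rightarrow> nat \<Rightarrow> real) \<Rightarrow> (nat \<Rightarrow> real)
    \<Rightarrow> (nat \<Rightarrow> bool) \<Rightarrow> nat \<Rightarrow> nat \<Rightarrow> real" where
  "ridge d C x y q t i = (if i < d then
     mv d (gram_inv d (1 / C\<^sup>2) (masked q x) t) (\<lambda>j. \<Sum>s<t. y s * masked q x s j) i else 0)"

section \<open>Normal equations, the minimiser and its error\<close>

lemma gram_cong: "(\<And>j. j < d \<Longrightarrow> a j = b j) \<Longrightarrow> i < d \<Longrightarrow> gram d c z t a i = gram d c z t b i"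
  unfolding gram_def by (intro arg_cong2[of _ _ _ _ "(+)"] sum.cong arg_cong2[of _ _ _ _ "(*)"] ip_cong) auto

text \<open>The normal equations, tested against an arbitrary vector \<open>h\<close>.\<close>

lemma ip_gram_ridge:
  assumes "C > 0"
  shows "ip d h (gram d (1 / C\<^sup>2) (masked q x) t (ridge d C x y q t))
    = (\<Sum>s<t. y s * ip d h (masked q x s))"
proof -
  have "gram d (1 / C\<^sup>2) (masked q x) t (ridge d C x y q t) i = (\<Sum>s<t. y s * masked q x s i)"
    if i: "i < d" for i
  proof -
    have "gram d (1 / C\<^sup>2) (masked q x) t (ridge d C x y q t) i
        = gram d (1 / C\<^sup>2) (masked q x) t
            (mv d (gram_inv d (1 / C\<^sup>2) (masked q x) t) (\<lambda>j. \<Sum>s<t. y s * masked q x s j)) i"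
      by (rule gram_cong) (auto simp: ridge_def i)
    then show ?thesis using assms i by (simp add: gram_gram_inv)
  qed
  then have "ip d h (gram d (1 / C\<^sup>2) (masked q x) t (ridge d C x y q t))
      = ip d h (\<lambda>i. \<Sum>s<t. y s * masked q x s i)"
    by (intro ip_cong) auto
  then show ?thesis by (simp add: ip_linear_right)
qed

text \<open>Expanding the quadratic objective around \<open>\<theta>\<close>, the normal equations
  kill the linear term and only the quadratic form of the difference remains.\<close>

lemma ridge_obj_eq:
  assumes C: "C > 0" and \<theta>: "\<theta> = ridge d C x y q t"
  shows "ridge_obj d C x y q t \<theta>' = ridge_obj d C x y q t \<theta>
    + (ip d (\<lambda>i. \<theta>' i - \<theta> i) (\<lambda>i. \<theta>' i - \<theta> i) / C\<^sup>2 + (\<Sum>s<t. (ip d (masked q x s) (\<lambda>i. \<theta>' i - \<theta> i))\<^sup>2))"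
proof -
  define h where "h = (\<lambda>i. \<theta>' i - \<theta> i)"
  have \<theta>': "\<theta>' = (\<lambda>i. \<theta> i + h i)" by (simp add: h_def)
  \<comment> \<open>Masking the label as well makes an unqueried round contribute a zero
    square.\<close>
  have obj: "ridge_obj d C x y q t v
    = (\<Sum>s<t. (ip d (masked q x s) v - (if q s then y s else 0))\<^sup>2) + ip d v v / C\<^sup>2" for v
    unfolding ridge_obj_def
    by (subst ip_commute[of d "masked _ _ _"])
       (auto simp: ip_masked intro!: sum.cong)
  have sq: "ip d \<theta>' \<theta>' = ip d \<theta> \<theta> + 2 * ip d h \<theta> + ip d h h"
    unfolding \<theta>' by (simp add: ip_def algebra_simps sum.distrib sum_distrib_left)
  have "(\<Sum>s<t. (ip d (masked q x s) \<theta>' - (if q s then y s else 0))\<^sup>2)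
    = (\<Sum>s<t. (ip d (masked q x s) \<theta> - (if q s then y s else 0))\<^sup>2
       + 2 * ((ip d (masked q x s) \<theta> * ip d h (masked q x s)) - y s * ip d h (masked q x s))
       + (ip d (masked q x s) h)\<^sup>2)"
    unfolding \<theta>' ip_add_right ip_commute[of d h]
    by (rule sum.cong)
      (auto simp: power2_eq_square algebra_simps ip_commute[of d "masked _ _ _"] ip_masked)
  also have "\<dots> = (\<Sum>s<t. (ip d (masked q x s) \<theta> - (if q s then y s else 0))\<^sup>2)
       + 2 * ((\<Sum>s<t. ip d (masked q x s) \<theta> * ip d h (masked q x s)) - (\<Sum>s<t. y s * ip d h (masked q x s)))
       + (\<Sum>s<t. (ip d (masked q x s) h)\<^sup>2)"
    by (simp add: sum.distrib sum_distrib_left sum_subtractf algebra_simps)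
  also have "(\<Sum>s<t. y s * ip d h (masked q x s)) = ip d h (gram d (1 / C\<^sup>2) (masked q x) t \<theta>)"
    unfolding \<theta> by (simp add: ip_gram_ridge C)
  also have "\<dots> = 1 / C\<^sup>2 * ip d h \<theta> + (\<Sum>s<t. ip d (masked q x s) \<theta> * ip d h (masked q x s))"
    unfolding gram_def ip_linear_right by simp
  finally show ?thesis unfolding obj sq h_def[symmetric]
    by (simp add: algebra_simps add_divide_distrib)
qed

lemma ridge_in_Vd: "ridge d C x y q t \<in> Vd d"
  by (simp add: Vd_def ridge_def)

text \<open>A competitor exceeds the objective of \<open>ridge\<close> by at least its squared
  distance over \<open>C\<^sup>2\<close>. The minimiser is therefore unique on coordinates below
  \<open>d\<close>, and membership in \<open>Vd d\<close> fixes the others.\<close>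

lemma theta_hat_eq_ridge:
  assumes C: "C > 0"
  shows "theta_hat d C x y q t = ridge d C x y q t"
  unfolding theta_hat_def
proof (rule the_equality)
  show "ridge d C x y q t \<in> Vd d \<and> (\<forall>\<theta>'\<in>Vd d. ridge_obj d C x y q t (ridge d C x y q t) \<le> ridge_obj d C x y q t \<theta>')"
  proof (intro conjI ballI ridge_in_Vd)
    fix \<theta>'
    show "ridge_obj d C x y q t (ridge d C x y q t) \<le> ridge_obj d C x y q t \<theta>'"
      unfolding ridge_obj_eq[OF C refl, of d x y q t \<theta>']
      by (simp add: ip_self_nonneg sum_nonneg)
  qed
next
  fix \<theta> assume \<theta>: "\<theta> \<in> Vd d \<and> (\<forall>\<theta>'\<in>Vd d. ridge_obj d C x y q t \<theta> \<le> ridge_obj d C x y q t \<theta>')"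
  define h where "h = (\<lambda>i. \<theta> i - ridge d C x y q t i)"
  have "ip d h h / C\<^sup>2 + (\<Sum>s<t. (ip d (masked q x s) h)\<^sup>2) \<le> 0"
    using bspec[OF conjunct2[OF \<theta>] ridge_in_Vd[of d C x y q t]]
    unfolding ridge_obj_eq[OF C refl, of d x y q t \<theta>] h_def by simp
  moreover have "(\<Sum>s<t. (ip d (masked q x s) h)\<^sup>2) \<ge> 0" by (intro sum_nonneg) auto
  ultimately have "ip d h h / C\<^sup>2 \<le> 0" by linarith
  then have "ip d h h = 0" using C ip_self_nonneg[of d h] by (simp add: divide_le_0_iff)
  then have "\<forall>i<d. h i = 0" by (simp add: ip_def sum_nonneg_eq_0_iff)
  then show "\<theta> = ridge d C x y q t"
    using conjunct1[OF \<theta>] ridge_in_Vd[of d C x y q t] unfolding h_def Vd_def fun_eq_iff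
    by (metis (mono_tags, lifting) mem_Collect_eq not_le eq_iff_diff_eq_0)
qed

text \<open>The bias-variance decomposition: a linear form in the noise minus a shrinkage bias.
  Writing \<open>v\<close> as the Gram operator applied to \<open>a\<close>, self-adjointness and
  the normal equations expand the estimate, and the signal terms cancel against those of the true
  value.\<close>

lemma theta_hat_error:
  fixes d C x q t v \<theta>s
  assumes C: "C > 0" and y: "\<And>s. s < t \<Longrightarrow> y s = ip d \<theta>s (x s) + \<xi> s"
  defines "a \<equiv> mv d (gram_inv d (1 / C\<^sup>2) (masked q x) t) v"
  shows "ip d (theta_hat d C x y q t) v - ip d \<theta>s v
    = (\<Sum>s<t. ip d (masked q x s) a * \<xi> s) - ip d \<theta>s a / C\<^sup>2"
proof -
  let ?G = "gram d (1 / C\<^sup>2) (masked q x) t" and ?z = "masked q x"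
  have v: "ip d u v = ip d u (?G a)" for u
    using C by (intro ip_cong) (auto simp: a_def gram_gram_inv)
  have "ip d (theta_hat d C x y q t) v = ip d a (?G (ridge d C x y q t))"
    unfolding v theta_hat_eq_ridge[OF C] by (metis ip_gram_self_adjoint ip_commute)
  also have "\<dots> = (\<Sum>s<t. y s * ip d a (?z s))" by (rule ip_gram_ridge[OF C])
  also have "\<dots> = (\<Sum>s<t. ip d \<theta>s (?z s) * ip d a (?z s)) + (\<Sum>s<t. ip d (?z s) a * \<xi> s)"
    unfolding sum.distrib[symmetric]
    by (rule sum.cong) (auto simp: y ip_masked ip_commute[of d "?z _"] algebra_simps)
  finally have "ip d (theta_hat d C x y q t) v
     = (\<Sum>s<t. ip d \<theta>s (?z s) * ip d a (?z s)) + (\<Sum>s<t. ip d (?z s) a * \<xi> s)" .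
  moreover have "ip d \<theta>s v = ip d \<theta>s a / C\<^sup>2 + (\<Sum>s<t. ip d \<theta>s (?z s) * ip d a (?z s))"
    unfolding v gram_def ip_linear_right by (simp add: ip_commute mult_ac)
  ultimately show ?thesis by simp
qed

text \<open>Causality of the estimator. It allows replacing the random query bits by a fixed
  pattern, and makes the estimate insensitive to the current round.\<close>

lemma theta_hat_cong:
  assumes "\<And>s. s < t \<Longrightarrow> q s = q' s" "\<And>s. s < t \<Longrightarrow> y s = y' s"
  shows "theta_hat d C x y q t = theta_hat d C x y' q' t"
proof -
  have "ridge_obj d C x y q t = ridge_obj d C x y' q' t"
    by (rule ext) (auto simp: ridge_obj_def assms intro!: sum.cong)
  then show ?thesis by (simp add: theta_hat_def)
qed

text \<open>Clipping projects onto [-1, 1], an interval of length 2 that contains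
  \<open>m\<close>.\<close>

lemma clip_error_le:
  assumes "\<bar>m\<bar> \<le> 1"
  shows "(clip p - m)\<^sup>2 \<le> (p - m)\<^sup>2" "(clip p - m)\<^sup>2 \<le> 4"
proof -
  have "\<bar>clip p - m\<bar> \<le> \<bar>p - m\<bar>" "\<bar>clip p - m\<bar> \<le> 2" using assms by (auto simp: clip_def)
  from this(1) abs_le_square_iff[of "clip p - m" 2] this(2)
  show "(clip p - m)\<^sup>2 \<le> (p - m)\<^sup>2" "(clip p - m)\<^sup>2 \<le> 4" by (auto simp: abs_le_square_iff)
qed

section \<open>Random queries and noise\<close>

text \<open>The square is dominated by the moment generating function: z^2 / (2 s^2) \<le> exp
  \<bar>z / s\<bar> \<le> exp (z / s) + exp (- z / s). Each exponential has mean at most exp (1/2)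
  \<le> 2, which gives the constant 8.\<close>

lemma subgaussian_variance:
  assumes N: "subgaussian N \<eta>" and \<eta>: "\<eta> \<ge> 0"
  shows "integrable N (\<lambda>z. z\<^sup>2)" and "(\<integral>z. z\<^sup>2 \<partial>N) \<le> 8 * (max 1 \<eta>)\<^sup>2"
proof -
  interpret prob_space N using N by (simp add: subgaussian_def)
  have [measurable_cong]: "sets N = sets borel" using N by (simp add: subgaussian_def)
  \<comment> \<open>The scale stays positive when \<open>\<eta>\<close> is 0, so evaluating at 1 / s
    is legitimate.\<close>
  define s where "s = max 1 \<eta>"
  have s: "s > 0" "\<eta>\<^sup>2 \<le> s\<^sup>2"
    using \<eta> by (auto simp: s_def intro: power_mono)
  let ?B = "\<lambda>z. 2 * s\<^sup>2 * (exp ((1 / s) * z) + exp ((- 1 / s) * z))"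
  have bound: "z\<^sup>2 \<le> ?B z" for z
  proof -
    have "\<bar>z / s\<bar>\<^sup>2 / 2 \<le> exp \<bar>z / s\<bar>"
      using exp_lower_Taylor_quadratic[of "\<bar>z / s\<bar>"] abs_ge_zero[of "z / s"] by linarith
    also have "\<dots> \<le> exp ((1 / s) * z) + exp ((- 1 / s) * z)"
      using s by (cases "z \<ge> 0") auto
    finally show ?thesis using s by (simp add: field_simps)
  qed
  have mgf: "integrable N (\<lambda>z. exp (l * z))" "(\<integral>z. exp (l * z) \<partial>N) \<le> exp (l\<^sup>2 * \<eta>\<^sup>2 / 2)" for l
    using N by (auto simp: subgaussian_def)
  have intB: "integrable N ?B" by (intro integrable_mult_right Bochner_Integration.integrable_add mgf)
  show sq: "integrable N (\<lambda>z. z\<^sup>2)"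
    by (rule Bochner_Integration.integrable_bound[OF intB]) (use bound in \<open>auto intro: order_trans[OF _ abs_ge_self]\<close>)
  have half: "(\<integral>z. exp (l * z) \<partial>N) \<le> 2" if "l\<^sup>2 = 1 / s\<^sup>2" for l
  proof -
    have "l\<^sup>2 * \<eta>\<^sup>2 / 2 \<le> 1 / 2" 
      using s mult_left_mono[OF s(2), of "1 / s\<^sup>2"] that by simp
    then have "(\<integral>z. exp (l * z) \<partial>N) \<le> exp (1 / 2)" using mgf(2)[of l] by (meson exp_le_cancel_iff order_trans)
    also have "\<dots> \<le> 2"
      using exp_bound_half[of "1/2 :: real"] by simp
    finally show ?thesis .
  qed
  have "(\<integral>z. z\<^sup>2 \<partial>N) \<le> (\<integral>z. ?B z \<partial>N)"
    by (rule integral_mono[OF sq intB]) (rule bound)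
  also have "\<dots> = 2 * s\<^sup>2 * ((\<integral>z. exp ((1 / s) * z) \<partial>N) + (\<integral>z. exp ((- 1 / s) * z) \<partial>N))"
    using mgf(1)[of "1 / s"] mgf(1)[of "- 1 / s"] by simp
  also have "\<dots> \<le> 2 * s\<^sup>2 * (2 + 2)"
    by (intro mult_left_mono add_mono half) (auto simp: power_divide)
  finally show "(\<integral>z. z\<^sup>2 \<partial>N) \<le> 8 * (max 1 \<eta>)\<^sup>2" by (simp add: s_def)
qed

text \<open>The noise law is sub-Gaussian at every index, not only below \<open>T\<close>, because
  \<open>product_prob_space\<close> asks for a family of probability spaces over all
  indices.\<close>

locale random_queries =
  fixes T :: nat and \<mu> \<eta> :: real and N :: "nat \<Rightarrow> real measure"
  assumes \<mu>: "0 < \<mu>" "\<mu> \<le> 1" and \<eta>: "\<eta> \<ge> 0" and N: "\<And>t. subgaussian (N t) \<eta>"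
begin

abbreviation "M t \<equiv> measure_pmf (bernoulli_pmf \<mu>) \<Otimes>\<^sub>M N t"
abbreviation "\<Omega> \<equiv> outcome_space T \<mu> N"

section \<open>Integration over the product of query bits and noise\<close>

lemma prob_space_N: "prob_space (N t)"
  using N by (simp add: subgaussian_def)

lemma sets_N [measurable_cong]: "sets (N t) = sets borel"
  using N by (simp add: subgaussian_def)

lemma N_prob [simp]: "measure (N t) (space (N t)) = 1"
  by (rule prob_space.prob_space[OF prob_space_N])

lemma prob_space_M: "prob_space (M t)"
proof -
  interpret N: prob_space "N t" by (rule prob_space_N)
  interpret pair_prob_space "measure_pmf (bernoulli_pmf \<mu>)" "N t" ..
  show ?thesis by (rule prob_space_axioms)
qed

sublocale product_prob_space M "{..<T}"
  by (rule product_prob_spaceI) (rule prob_space_M)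

sublocale \<Omega>: prob_space \<Omega>
  unfolding outcome_space_def by unfold_locales

lemma measurable_query [measurable]: "t < T \<Longrightarrow> Measurable.pred \<Omega> (\<lambda>\<omega>. fst (\<omega> t))"
  unfolding outcome_space_def by measurable

lemma measurable_noise [measurable]: "t < T \<Longrightarrow> (\<lambda>\<omega>. snd (\<omega> t)) \<in> borel_measurable \<Omega>"
  unfolding outcome_space_def by measurable

lemma bounded_integrable:
  fixes f :: "(nat \<Rightarrow> bool \<times> real) \<Rightarrow> real"
  shows "f \<in> borel_measurable \<Omega> \<Longrightarrow> (\<And>\<omega>. \<bar>f \<omega>\<bar> \<le> B) \<Longrightarrow> integrable \<Omega> f"
  by (rule \<Omega>.integrable_const_bound[where B=B]) auto

lemma pair_integral:
  fixes g :: "real \<Rightarrow> real" and h :: "bool \<Rightarrow> real"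
  assumes g: "integrable (N t) g"
  shows "integrable (M t) (\<lambda>p. h (fst p) * g (snd p))"
    and "(\<integral>p. h (fst p) * g (snd p) \<partial>M t) = (\<mu> * h True + (1 - \<mu>) * h False) * (\<integral>z. g z \<partial>N t)"
proof -
  interpret N: prob_space "N t" by (rule prob_space_N)
  interpret pair_prob_space "measure_pmf (bernoulli_pmf \<mu>)" "N t" ..
  have [measurable]: "g \<in> borel_measurable (N t)" using g by simp
  show int: "integrable (M t) (\<lambda>p. h (fst p) * g (snd p))"
    by (rule Fubini_integrable) (auto simp: abs_mult g intro!: integrable_measure_pmf_finite)
  have "(\<integral>p. h (fst p) * g (snd p) \<partial>M t)
      = (\<integral>b. (\<integral>z. h b * g z \<partial>N t) \<partial>measure_pmf (bernoulli_pmf \<mu>))"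
    using integral_fst'[OF int] by simp
  also have "\<dots> = (\<mu> * h True + (1 - \<mu>) * h False) * (\<integral>z. g z \<partial>N t)"
    using \<mu> by (subst integral_measure_pmf_real[of UNIV]) (auto simp: UNIV_bool algebra_simps)
  finally show "(\<integral>p. h (fst p) * g (snd p) \<partial>M t) = (\<mu> * h True + (1 - \<mu>) * h False) * (\<integral>z. g z \<partial>N t)" .
qed

text \<open>Independence from round \<open>t\<close> is expressed as invariance under updating
  coordinate \<open>t\<close>. Integrating that coordinate first turns the query bit into
  \<open>\<mu>\<close>.\<close>

lemma integral_query_mult:
  fixes f :: "(nat \<Rightarrow> bool \<times> real) \<Rightarrow> real"
  assumes t: "t < T" and [measurable]: "f \<in> borel_measurable \<Omega>" and B: "\<And>\<omega>. \<bar>f \<omega>\<bar> \<le> B"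
    and upd: "\<And>\<omega> p. f (fun_upd \<omega> t p) = f \<omega>"
  shows "(\<integral>\<omega>. of_bool (fst (\<omega> t)) * f \<omega> \<partial>\<Omega>) = \<mu> * (\<integral>\<omega>. f \<omega> \<partial>\<Omega>)"
proof -
  let ?I = "{..<T} - {t}"
  have I: "insert t ?I = {..<T}" using t by auto
  interpret N: prob_space "N t" by (rule prob_space_N)
  have meas [measurable]: "(\<lambda>\<omega>. of_bool (fst (\<omega> t)) * f \<omega>) \<in> borel_measurable \<Omega>"
    using t unfolding of_bool_def by measurable
  have "integrable \<Omega> (\<lambda>\<omega>. of_bool (fst (\<omega> t)) * f \<omega>)"
    by (rule bounded_integrable[OF meas, where B="\<bar>B\<bar>"])
       (use B in \<open>auto simp: abs_mult intro: order_trans[OF _ abs_ge_self]\<close>)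
  then have "(\<integral>\<omega>. of_bool (fst (\<omega> t)) * f \<omega> \<partial>\<Omega>)
      = (\<integral>\<omega>. (\<integral>p. of_bool (fst p) * f \<omega> \<partial>M t) \<partial>PiM ?I M)"
    unfolding outcome_space_def 
    using product_integral_insert[of ?I t "\<lambda>\<omega>. of_bool (fst (\<omega> t)) * f \<omega>", unfolded I] by (simp add: upd)
  also have "\<dots> = (\<integral>\<omega>. \<mu> * f \<omega> \<partial>PiM ?I M)"
    using pair_integral(2)[of t "\<lambda>_. _" "\<lambda>b. of_bool b"] by (simp add: N.prob_space)
  also have "\<dots> = \<mu> * (\<integral>\<omega>. f \<omega> \<partial>PiM ?I M)" by simp
  \<comment> \<open>The same splitting without the query bit: coordinate \<open>t\<close> integrates
    to 1.\<close>
  also have "(\<integral>\<omega>. f \<omega> \<partial>PiM ?I M) = (\<integral>\<omega>. f \<omega> \<partial>\<Omega>)"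
  proof -
    have "integrable \<Omega> f" by (rule bounded_integrable) (use B in auto)
    then show ?thesis
      unfolding outcome_space_def 
      using product_integral_insert[of ?I t f, unfolded I] by (simp add: upd prob_space.prob_space[OF prob_space_M])
  qed
  finally show ?thesis .
qed

section \<open>Noise moments on a fixed query pattern\<close>

text \<open>The indicator of a query pattern in product form, so that it factors over the product
  measure.\<close>

definition pattern :: "(nat \<Rightarrow> bool) \<Rightarrow> (nat \<Rightarrow> bool \<times> real) \<Rightarrow> real" where
  "pattern q \<omega> = (\<Prod>i<T. of_bool (fst (\<omega> i) = q i))"

definition pattern_prob :: "(nat \<Rightarrow> bool) \<Rightarrow> real" where
  "pattern_prob q = (\<Prod>i<T. if q i then \<mu> else 1 - \<mu>)"

text \<open>Extensional functions make the set finite and count each pattern once.\<close>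

abbreviation patterns :: "(nat \<Rightarrow> bool) set" where
  "patterns \<equiv> PiE {..<T} (\<lambda>_. UNIV)"

lemma pattern_eq: "pattern q \<omega> = of_bool (\<forall>i<T. fst (\<omega> i) = q i)"
  by (auto simp: pattern_def prod_zero_iff)

lemma sum_pattern: "(\<Sum>q\<in>patterns. pattern q \<omega>) = 1"
proof -
  have "(\<Sum>q\<in>patterns. pattern q \<omega>) = (\<Prod>i<T. \<Sum>b\<in>UNIV. of_bool (fst (\<omega> i) = b))"
    unfolding pattern_def by (rule prod_sum_PiE[symmetric]) auto
  also have "\<dots> = 1" by (rule prod.neutral) (simp add: UNIV_bool)
  finally show ?thesis .
qed

lemma sum_pattern_prob: "(\<Sum>q\<in>patterns. pattern_prob q) = 1"
proof -
  have "(\<Sum>q\<in>patterns. pattern_prob q) = (\<Prod>i<T. \<Sum>b\<in>UNIV. if b then \<mu> else 1 - \<mu>)"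
    unfolding pattern_prob_def by (rule prod_sum_PiE[symmetric]) auto
  also have "\<dots> = 1" by (rule prod.neutral) (simp add: UNIV_bool)
  finally show ?thesis .
qed

lemma pattern_prob_nonneg: "pattern_prob q \<ge> 0"
  using \<mu> by (auto simp: pattern_prob_def intro!: prod_nonneg)

text \<open>The integrand is a product of functions of single coordinates. Weighting by the
  indicator replaces conditioning and avoids dividing by \<open>pattern_prob q\<close>, which can be
  0 when \<open>\<mu>\<close> is 1.\<close>

lemma pattern_integral_prod:
  fixes g :: "nat \<Rightarrow> real \<Rightarrow> real"
  assumes g: "\<And>i. i < T \<Longrightarrow> integrable (N i) (g i)"
  shows "integrable \<Omega> (\<lambda>\<omega>. pattern q \<omega> * (\<Prod>i<T. g i (snd (\<omega> i))))"
    and "(\<integral>\<omega>. pattern q \<omega> * (\<Prod>i<T. g i (snd (\<omega> i))) \<partial>\<Omega>) = pattern_prob q * (\<Prod>i<T. \<integral>z. g i z \<partial>N i)"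
proof -
  have eq: "pattern q \<omega> * (\<Prod>i<T. g i (snd (\<omega> i)))
      = (\<Prod>i<T. of_bool (fst (\<omega> i) = q i) * g i (snd (\<omega> i)))" for \<omega> :: "nat \<Rightarrow> bool \<times> real"
    by (simp add: pattern_def prod.distrib)
  have int: "integrable (M i) (\<lambda>p. of_bool (fst p = q i) * g i (snd p))" if "i < T" for i
    using pair_integral(1)[OF g[OF that], of "\<lambda>b. of_bool (b = q i)"] by simp
  show "integrable \<Omega> (\<lambda>\<omega>. pattern q \<omega> * (\<Prod>i<T. g i (snd (\<omega> i))))"
    unfolding eq outcome_space_def
    by (rule product_integrable_prod[of "{..<T}" "\<lambda>i p. of_bool (fst p = q i) * g i (snd p)"]) (auto intro: int)
  have "(\<integral>\<omega>. pattern q \<omega> * (\<Prod>i<T. g i (snd (\<omega> i))) \<partial>\<Omega>)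
      = (\<Prod>i<T. \<integral>p. of_bool (fst p = q i) * g i (snd p) \<partial>M i)"
    unfolding eq outcome_space_def
    by (rule product_integral_prod[of "{..<T}" "\<lambda>i p. of_bool (fst p = q i) * g i (snd p)"]) (auto intro: int)
  also have "\<dots> = (\<Prod>i<T. (if q i then \<mu> else 1 - \<mu>) * (\<integral>z. g i z \<partial>N i))"
    by (rule prod.cong) (auto simp: pair_integral(2)[OF g, of _ "\<lambda>b. of_bool (b = q _)"])
  finally show "(\<integral>\<omega>. pattern q \<omega> * (\<Prod>i<T. g i (snd (\<omega> i))) \<partial>\<Omega>)
      = pattern_prob q * (\<Prod>i<T. \<integral>z. g i z \<partial>N i)"
    by (simp add: pattern_prob_def prod.distrib)
qed

lemma N_moments:
  "integrable (N i) (\<lambda>z. z)" "(\<integral>z. z \<partial>N i) = 0" "(\<integral>z. 1 \<partial>N i) = (1 :: real)"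
  "integrable (N i) (\<lambda>z. z\<^sup>2)" "(\<integral>z. z\<^sup>2 \<partial>N i) \<le> 8 * (max 1 \<eta>)\<^sup>2"
  using N[of i, unfolded subgaussian_def] subgaussian_variance[OF N[of i] \<eta>] by simp_all

lemma integrable_N_const: "integrable (N i) (\<lambda>_. c :: real)"
proof -
  interpret prob_space "N i" by (rule prob_space_N)
  show ?thesis by simp
qed

lemma pattern_integral:
  shows "integrable \<Omega> (pattern q)" and "(\<integral>\<omega>. pattern q \<omega> \<partial>\<Omega>) = pattern_prob q"
  using pattern_integral_prod[of "\<lambda>_ _. 1" q] by (simp_all add: N_moments integrable_N_const)

lemma pattern_integral_noise:
  assumes s: "s < T"
  shows "integrable \<Omega> (\<lambda>\<omega>. pattern q \<omega> * snd (\<omega> s))" and "(\<integral>\<omega>. pattern q \<omega> * snd (\<omega> s) \<partial>\<Omega>) = 0"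
proof -
  let ?g = "\<lambda>i z. if i = s then z else (1::real)"
  have g: "integrable (N i) (?g i)" for i
    by (cases "i = s") (auto simp: N_moments integrable_N_const)
  have eq: "(\<Prod>i<T. ?g i (snd (\<omega> i))) = snd (\<omega> s)" for \<omega> :: "nat \<Rightarrow> bool \<times> real"
    using s by simp
  have "(\<integral>z. ?g s z \<partial>N s) = 0" by (simp add: N_moments)
  then have "(\<Prod>i<T. \<integral>z. ?g i z \<partial>N i) = 0" using s by (intro prod_zero bexI[of _ s]) auto
  then show "integrable \<Omega> (\<lambda>\<omega>. pattern q \<omega> * snd (\<omega> s))" "(\<integral>\<omega>. pattern q \<omega> * snd (\<omega> s) \<partial>\<Omega>) = 0"
    using pattern_integral_prod[of ?g q, OF g] unfolding eq by simp_all
qed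

lemma pattern_integral_noise_mult:
  assumes s: "s < T" and r: "r < T"
  shows "integrable \<Omega> (\<lambda>\<omega>. pattern q \<omega> * (snd (\<omega> s) * snd (\<omega> r)))"
    and "(\<integral>\<omega>. pattern q \<omega> * (snd (\<omega> s) * snd (\<omega> r)) \<partial>\<Omega>)
      = (if s = r then pattern_prob q * (\<integral>z. z\<^sup>2 \<partial>N s) else 0)"
proof -
  \<comment> \<open>Two separate factors treat both cases at once: they multiply to a square when
    \<open>s = r\<close>, and otherwise leave a mean-zero factor at \<open>s\<close>.\<close>
  let ?g = "\<lambda>i z. (if i = s then z else (1::real)) * (if i = r then z else 1)"
  have g: "integrable (N i) (?g i)" for i
    by (cases "i = s"; cases "i = r")
       (auto simp: N_moments integrable_N_const simp flip: power2_eq_square)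
  have eq: "(\<Prod>i<T. ?g i (snd (\<omega> i))) = snd (\<omega> s) * snd (\<omega> r)" for \<omega> :: "nat \<Rightarrow> bool \<times> real"
    using s r by (simp add: prod.distrib)
  have "(\<Prod>i<T. \<integral>z. ?g i z \<partial>N i) = (if s = r then (\<integral>z. z\<^sup>2 \<partial>N s) else 0)"
  proof (cases "s = r")
    case True
    have "(\<Prod>i<T. \<integral>z. ?g i z \<partial>N i) = (\<Prod>i<T. if i = s then (\<integral>z. z\<^sup>2 \<partial>N s) else 1)"
      by (rule prod.cong) (use True in \<open>auto simp: N_moments(3) power2_eq_square\<close>)
    then show ?thesis using True s by simp
  next
    case False
    then have "(\<integral>z. ?g s z \<partial>N s) = 0" by (simp add: N_moments)
    then show ?thesis using s False by (auto intro!: prod_zero bexI[of _ s])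
  qed
  then show "integrable \<Omega> (\<lambda>\<omega>. pattern q \<omega> * (snd (\<omega> s) * snd (\<omega> r)))"
    "(\<integral>\<omega>. pattern q \<omega> * (snd (\<omega> s) * snd (\<omega> r)) \<partial>\<Omega>)
      = (if s = r then pattern_prob q * (\<integral>z. z\<^sup>2 \<partial>N s) else 0)"
    using pattern_integral_prod[of ?g q, OF g] unfolding eq by simp_all
qed

text \<open>After expanding the square, the linear terms and the off-diagonal products integrate to
  0, leaving the variances and the squared bias.\<close>

lemma pattern_integral_affine_sq:
  assumes t: "t \<le> T"
  shows "integrable \<Omega> (\<lambda>\<omega>. pattern q \<omega> * ((\<Sum>s<t. a s * snd (\<omega> s)) - b)\<^sup>2)"
    and "(\<integral>\<omega>. pattern q \<omega> * ((\<Sum>s<t. a s * snd (\<omega> s)) - b)\<^sup>2 \<partial>\<Omega>)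
      \<le> pattern_prob q * (8 * (max 1 \<eta>)\<^sup>2 * (\<Sum>s<t. (a s)\<^sup>2) + b\<^sup>2)"
proof -
  let ?F = "\<lambda>\<omega>. (\<Sum>s<t. \<Sum>r<t. a s * a r * (pattern q \<omega> * (snd (\<omega> s) * snd (\<omega> r))))
       - (\<Sum>s<t. 2 * b * a s * (pattern q \<omega> * snd (\<omega> s))) + b\<^sup>2 * pattern q \<omega>"
  have eq: "pattern q \<omega> * ((\<Sum>s<t. a s * snd (\<omega> s)) - b)\<^sup>2 = ?F \<omega>" for \<omega>
  proof -
    let ?S = "\<Sum>s<t. a s * snd (\<omega> s)"
    have "pattern q \<omega> * (?S - b)\<^sup>2 = pattern q \<omega> * (?S * ?S) - 2 * b * pattern q \<omega> * ?S + b\<^sup>2 * pattern q \<omega>"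
      by (simp add: power2_eq_square algebra_simps)
    also have "pattern q \<omega> * (?S * ?S) = (\<Sum>s<t. \<Sum>r<t. a s * a r * (pattern q \<omega> * (snd (\<omega> s) * snd (\<omega> r))))"
      unfolding sum_product by (simp add: sum_distrib_left mult_ac)
    also have "2 * b * pattern q \<omega> * ?S = (\<Sum>s<t. 2 * b * a s * (pattern q \<omega> * snd (\<omega> s)))"
      unfolding sum_distrib_left by (intro sum.cong refl) (simp add: mult_ac)
    finally show ?thesis .
  qed
  have lt: "s < T" if "s \<in> {..<t}" for s using that t by simp
  have i2: "integrable \<Omega> (\<lambda>\<omega>. \<Sum>s<t. \<Sum>r<t. a s * a r * (pattern q \<omega> * (snd (\<omega> s) * snd (\<omega> r))))"
    by (intro Bochner_Integration.integrable_sum integrable_mult_right pattern_integral_noise_mult(1) lt)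
  have i1: "integrable \<Omega> (\<lambda>\<omega>. \<Sum>s<t. 2 * b * a s * (pattern q \<omega> * snd (\<omega> s)))"
    by (intro Bochner_Integration.integrable_sum integrable_mult_right pattern_integral_noise(1) lt)
  have i0: "integrable \<Omega> (\<lambda>\<omega>. b\<^sup>2 * pattern q \<omega>)"
    by (intro integrable_mult_right pattern_integral)
  show "integrable \<Omega> (\<lambda>\<omega>. pattern q \<omega> * ((\<Sum>s<t. a s * snd (\<omega> s)) - b)\<^sup>2)"
    unfolding eq by (intro Bochner_Integration.integrable_add Bochner_Integration.integrable_diff i0 i1 i2)
  have "(\<integral>\<omega>. (\<Sum>s<t. \<Sum>r<t. a s * a r * (pattern q \<omega> * (snd (\<omega> s) * snd (\<omega> r)))) \<partial>\<Omega>)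
      = (\<Sum>s<t. \<integral>\<omega>. (\<Sum>r<t. a s * a r * (pattern q \<omega> * (snd (\<omega> s) * snd (\<omega> r)))) \<partial>\<Omega>)"
    by (rule Bochner_Integration.integral_sum)
       (intro Bochner_Integration.integrable_sum integrable_mult_right pattern_integral_noise_mult(1) lt)
  also have "\<dots> = (\<Sum>s<t. \<Sum>r<t. a s * a r * (if s = r then pattern_prob q * (\<integral>z. z\<^sup>2 \<partial>N s) else 0))"
  proof (rule sum.cong[OF refl])
    fix s assume s: "s \<in> {..<t}"
    have "(\<integral>\<omega>. (\<Sum>r<t. a s * a r * (pattern q \<omega> * (snd (\<omega> s) * snd (\<omega> r)))) \<partial>\<Omega>)
        = (\<Sum>r<t. \<integral>\<omega>. a s * a r * (pattern q \<omega> * (snd (\<omega> s) * snd (\<omega> r))) \<partial>\<Omega>)"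
      by (rule Bochner_Integration.integral_sum)
         (intro integrable_mult_right pattern_integral_noise_mult(1) lt s)
    then show "(\<integral>\<omega>. (\<Sum>r<t. a s * a r * (pattern q \<omega> * (snd (\<omega> s) * snd (\<omega> r)))) \<partial>\<Omega>)
        = (\<Sum>r<t. a s * a r * (if s = r then pattern_prob q * (\<integral>z. z\<^sup>2 \<partial>N s) else 0))"
      using lt s by (simp only: integral_mult_right_zero pattern_integral_noise_mult(2) cong: sum.cong)
  qed
  also have "\<dots> = (\<Sum>s<t. pattern_prob q * ((a s)\<^sup>2 * (\<integral>z. z\<^sup>2 \<partial>N s)))"
    by (intro sum.cong refl) (simp add: if_distrib power2_eq_square mult_ac cong: if_cong)
  finally have e2: "(\<integral>\<omega>. (\<Sum>s<t. \<Sum>r<t. a s * a r * (pattern q \<omega> * (snd (\<omega> s) * snd (\<omega> r)))) \<partial>\<Omega>)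
      = (\<Sum>s<t. pattern_prob q * ((a s)\<^sup>2 * (\<integral>z. z\<^sup>2 \<partial>N s)))" .
  have e1: "(\<integral>\<omega>. (\<Sum>s<t. 2 * b * a s * (pattern q \<omega> * snd (\<omega> s))) \<partial>\<Omega>) = 0"
    by (subst Bochner_Integration.integral_sum)
       (auto simp: pattern_integral_noise lt intro!: integrable_mult_right sum.neutral)
  have "(\<integral>\<omega>. pattern q \<omega> * ((\<Sum>s<t. a s * snd (\<omega> s)) - b)\<^sup>2 \<partial>\<Omega>)
      = (\<Sum>s<t. pattern_prob q * ((a s)\<^sup>2 * (\<integral>z. z\<^sup>2 \<partial>N s))) + b\<^sup>2 * pattern_prob q"
    unfolding eq
    by (subst Bochner_Integration.integral_add[OF Bochner_Integration.integrable_diff[OF i2 i1] i0],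
        subst Bochner_Integration.integral_diff[OF i2 i1])
       (simp add: e2 e1 pattern_integral)
  also have "\<dots> \<le> (\<Sum>s<t. pattern_prob q * ((a s)\<^sup>2 * (8 * (max 1 \<eta>)\<^sup>2))) + b\<^sup>2 * pattern_prob q"
    by (intro add_mono sum_mono mult_left_mono N_moments pattern_prob_nonneg order_refl) auto
  also have "\<dots> = pattern_prob q * (8 * (max 1 \<eta>)\<^sup>2 * (\<Sum>s<t. (a s)\<^sup>2) + b\<^sup>2)"
    by (simp add: sum_distrib_left algebra_simps)
  finally show "(\<integral>\<omega>. pattern q \<omega> * ((\<Sum>s<t. a s * snd (\<omega> s)) - b)\<^sup>2 \<partial>\<Omega>)
      \<le> pattern_prob q * (8 * (max 1 \<eta>)\<^sup>2 * (\<Sum>s<t. (a s)\<^sup>2) + b\<^sup>2)" .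
qed

end

section \<open>Expected regret\<close>

locale oblivious_regression = random_queries +
  fixes d :: nat and C :: real and \<theta>s :: "nat \<Rightarrow> real" and x :: "nat \<Rightarrow> nat \<Rightarrow> real"
  assumes C: "C > 0" and \<theta>s: "ip d \<theta>s \<theta>s \<le> C\<^sup>2"
    and x: "\<And>t. t < T \<Longrightarrow> ip d (x t) (x t) \<le> 1" "\<And>t. t < T \<Longrightarrow> \<bar>ip d \<theta>s (x t)\<bar> \<le> 1"
begin

abbreviation lev :: "(nat \<Rightarrow> bool) \<Rightarrow> nat \<Rightarrow> real" where
  "lev q t \<equiv> leverage d (1 / C\<^sup>2) (masked q x) t (x t)"

definition sq_error :: "nat \<Rightarrow> (nat \<Rightarrow> bool \<times> real) \<Rightarrow> real" where
  "sq_error t \<omega> = (prediction d C \<theta>s x \<omega> t - ip d \<theta>s (x t))\<^sup>2"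

lemma sq_error_bounds: "t < T \<Longrightarrow> 0 \<le> sq_error t \<omega>" "t < T \<Longrightarrow> sq_error t \<omega> \<le> 4"
  by (auto simp: sq_error_def prediction_def intro: clip_error_le x)

lemma abs_sq_error_le: "t < T \<Longrightarrow> \<bar>sq_error t \<omega>\<bar> \<le> 4"
  using sq_error_bounds[of t \<omega>] by simp

lemma sq_error_upd: "sq_error t (fun_upd \<omega> t p) = sq_error t \<omega>"
proof -
  have "theta_hat d C x (labels d \<theta>s x (fun_upd \<omega> t p)) (\<lambda>i. fst (fun_upd \<omega> t p i)) t
      = theta_hat d C x (labels d \<theta>s x \<omega>) (\<lambda>i. fst (\<omega> i)) t"
    by (rule theta_hat_cong) (auto simp: labels_def)
  then show ?thesis by (simp add: sq_error_def prediction_def)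
qed

section \<open>Measurability and per-round error bounds\<close>

text \<open>The Sherman-Morrison recursion uses only arithmetic in the query bits, so measurability
  follows by induction.\<close>

lemma measurable_gram_inv:
  "t \<le> T \<Longrightarrow> (\<lambda>\<omega>. gram_inv d c (masked (\<lambda>i. fst (\<omega> i)) x) t i j) \<in> borel_measurable \<Omega>"
proof (induction t arbitrary: i j)
  case (Suc t)
  have [measurable]: "(\<lambda>\<omega>. gram_inv d c (masked (\<lambda>i. fst (\<omega> i)) x) t i j) \<in> borel_measurable \<Omega>" for i j
    using Suc by simp
  have "t < T" using Suc by simp
  then have [measurable]: "(\<lambda>\<omega>. masked (\<lambda>i. fst (\<omega> i)) x t j) \<in> borel_measurable \<Omega>" for j
    unfolding masked_def by measurable
  show ?case unfolding gram_inv.simps mv_def ip_def by measurable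
qed simp

lemma measurable_sq_error [measurable]:
  assumes t: "t < T"
  shows "sq_error t \<in> borel_measurable \<Omega>"
proof -
  have [measurable]: "(\<lambda>\<omega>. gram_inv d c (masked (\<lambda>i. fst (\<omega> i)) x) t i j) \<in> borel_measurable \<Omega>" for c i j
    using t by (intro measurable_gram_inv) simp
  have [measurable]: "(\<lambda>\<omega>. masked (\<lambda>i. fst (\<omega> i)) x s j) \<in> borel_measurable \<Omega>" if "s < t" for s j
  proof -
    have "s < T" using t that by simp
    then show ?thesis unfolding masked_def by measurable
  qed
  have [measurable]: "(\<lambda>\<omega>. snd (\<omega> s)) \<in> borel_measurable \<Omega>" if "s < t" for s
    using t that by (intro measurable_noise) simp
  have [measurable]: "(\<lambda>\<omega>. \<Sum>s<t. (ip d \<theta>s (x s) + snd (\<omega> s)) * masked (\<lambda>i. fst (\<omega> i)) x s j) \<in> borel_measurable \<Omega>" for j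
    by (rule borel_measurable_sum) measurable
  have [measurable]: "(\<lambda>\<omega>. ip d (ridge d C x (labels d \<theta>s x \<omega>) (\<lambda>i. fst (\<omega> i)) t) (x t)) \<in> borel_measurable \<Omega>"
    unfolding ip_def[of d "ridge _ _ _ _ _ _"] ridge_def mv_def labels_def by measurable
  show ?thesis
    unfolding sq_error_def[abs_def] prediction_def theta_hat_eq_ridge[OF C] clip_def
    by measurable
qed

lemma integrable_sq_error: "t < T \<Longrightarrow> integrable \<Omega> (sq_error t)"
  by (rule bounded_integrable[where B=4]) (auto intro: abs_sq_error_le)

text \<open>Two bounds give the minimum: dropping the clipping yields the leverage through the
  bias-variance decomposition, and clipping yields the constant 4.\<close>

lemma pattern_integral_sq_error:
  assumes t: "t < T"
  shows "(\<integral>\<omega>. pattern q \<omega> * sq_error t \<omega> \<partial>\<Omega>) \<le> pattern_prob q * (8 * (max 1 \<eta>)\<^sup>2 * min 1 (lev q t))"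
proof -
  define a where "a = mv d (gram_inv d (1 / C\<^sup>2) (masked q x) t) (x t)"
  define b where "b = ip d \<theta>s a / C\<^sup>2"
  let ?a = "\<lambda>s. ip d (masked q x s) a"
  have \<eta>1: "1 \<le> (max 1 \<eta>)\<^sup>2" by simp
  have [measurable]: "pattern q \<in> borel_measurable \<Omega>"
    using pattern_integral(1) by (rule borel_measurable_integrable)
  have int: "integrable \<Omega> (\<lambda>\<omega>. pattern q \<omega> * sq_error t \<omega>)"
    by (rule bounded_integrable[where B=4])
       (use t sq_error_bounds[of t] in \<open>auto simp: pattern_eq\<close>)
  have le: "pattern q \<omega> * sq_error t \<omega> \<le> pattern q \<omega> * ((\<Sum>s<t. ?a s * snd (\<omega> s)) - b)\<^sup>2" for \<omega>
  proof (cases "\<forall>i<T. fst (\<omega> i) = q i")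
    case True
    have "theta_hat d C x (labels d \<theta>s x \<omega>) (\<lambda>i. fst (\<omega> i)) t = theta_hat d C x (labels d \<theta>s x \<omega>) q t"
      using True t by (intro theta_hat_cong) auto
    then have "sq_error t \<omega> \<le> (ip d (theta_hat d C x (labels d \<theta>s x \<omega>) q t) (x t) - ip d \<theta>s (x t))\<^sup>2"
      using clip_error_le(1)[OF x(2)[OF t]] by (simp add: sq_error_def prediction_def)
    also have "\<dots> = ((\<Sum>s<t. ?a s * snd (\<omega> s)) - b)\<^sup>2"
      unfolding a_def b_def by (subst theta_hat_error[OF C, where \<xi>="\<lambda>s. snd (\<omega> s)"]) (auto simp: labels_def)
    finally show ?thesis by (simp add: pattern_eq)
  next
    case False
    then have "pattern q \<omega> = 0" unfolding pattern_eq by (simp only: of_bool_eq)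
    then show ?thesis by simp
  qed
  have lev: "lev q t = ip d a a / C\<^sup>2 + (\<Sum>s<t. (?a s)\<^sup>2)"
    using leverage_eq[of "1 / C\<^sup>2" a d "masked q x" t "x t"] C by (simp add: a_def)
  \<comment> \<open>The regularisation weight matches the norm bound: Cauchy-Schwarz and \<theta>*
    of norm at most C bound the squared bias by the regulariser part of the leverage.\<close>
  have "b\<^sup>2 \<le> ip d \<theta>s \<theta>s * ip d a a / C ^ 4"
    unfolding b_def power_divide using ip_Cauchy_Schwarz[of d \<theta>s a] by (simp add: divide_right_mono flip: power_mult)
  also have "\<dots> \<le> C\<^sup>2 * ip d a a / C ^ 4"
    using \<theta>s by (intro divide_right_mono mult_right_mono ip_self_nonneg) auto
  also have "\<dots> = ip d a a / C\<^sup>2" using C by (simp add: power2_eq_square power4_eq_xxxx)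
  finally have b: "b\<^sup>2 \<le> ip d a a / C\<^sup>2" .
  have "(\<integral>\<omega>. pattern q \<omega> * sq_error t \<omega> \<partial>\<Omega>) \<le> (\<integral>\<omega>. pattern q \<omega> * ((\<Sum>s<t. ?a s * snd (\<omega> s)) - b)\<^sup>2 \<partial>\<Omega>)"
    by (rule integral_mono[OF int pattern_integral_affine_sq(1)]) (use t le in auto)
  also have "\<dots> \<le> pattern_prob q * (8 * (max 1 \<eta>)\<^sup>2 * (\<Sum>s<t. (?a s)\<^sup>2) + b\<^sup>2)"
    by (rule pattern_integral_affine_sq) (use t in simp)
  also have "\<dots> \<le> pattern_prob q * (8 * (max 1 \<eta>)\<^sup>2 * lev q t)"
  proof (intro mult_left_mono pattern_prob_nonneg)
    \<comment> \<open>The variance factor is at least 1, so it may also multiply the bias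
      part.\<close>
    have "b\<^sup>2 \<le> 8 * (max 1 \<eta>)\<^sup>2 * (ip d a a / C\<^sup>2)"
      using b mult_right_mono[of 1 "8 * (max 1 \<eta>)\<^sup>2" "ip d a a / C\<^sup>2"] \<eta>1 ip_self_nonneg[of d a] by simp
    then show "8 * (max 1 \<eta>)\<^sup>2 * (\<Sum>s<t. (?a s)\<^sup>2) + b\<^sup>2 \<le> 8 * (max 1 \<eta>)\<^sup>2 * lev q t"
      unfolding lev by (simp add: algebra_simps)
  qed
  finally have 1: "(\<integral>\<omega>. pattern q \<omega> * sq_error t \<omega> \<partial>\<Omega>) \<le> pattern_prob q * (8 * (max 1 \<eta>)\<^sup>2 * lev q t)" .
  have "(\<integral>\<omega>. pattern q \<omega> * sq_error t \<omega> \<partial>\<Omega>) \<le> (\<integral>\<omega>. pattern q \<omega> * 4 \<partial>\<Omega>)"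
    by (rule integral_mono[OF int integrable_mult_left[OF pattern_integral(1)]])
       (use t sq_error_bounds[of t] in \<open>auto simp: pattern_eq\<close>)
  also have "\<dots> = pattern_prob q * 4" by (simp add: pattern_integral)
  also have "\<dots> \<le> pattern_prob q * (8 * (max 1 \<eta>)\<^sup>2 * 1)"
    using \<eta>1 by (intro mult_left_mono pattern_prob_nonneg) linarith
  finally show ?thesis using 1 by (auto simp: min_def)
qed

text \<open>The potential bound is applied to the masked vectors, which equal \<open>x t\<close>
  exactly where the summand on the left can be nonzero.\<close>

lemma sum_min_lev_le:
  assumes dT: "d \<le> T" and T: "T \<ge> 1"
  shows "(\<Sum>t<T. of_bool (q t) * min 1 (lev q t)) \<le> 4 * real d * (1 + ln (real T) + ln (1 + C))"
proof -
  have "(\<Sum>t<T. of_bool (q t) * min 1 (lev q t))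
      \<le> (\<Sum>t<T. min 1 (leverage d (1 / C\<^sup>2) (masked q x) t (masked q x t)))"
  proof (rule sum_mono)
    fix t
    have "0 \<le> leverage d (1 / C\<^sup>2) (masked q x) t (masked q x t)"
      by (rule leverage_nonneg) (use C in simp)
    moreover have "q t \<Longrightarrow> masked q x t = x t" by (simp add: masked_apply)
    ultimately show "of_bool (q t) * min 1 (lev q t)
        \<le> min 1 (leverage d (1 / C\<^sup>2) (masked q x) t (masked q x t))"
      by (cases "q t") simp_all
  qed
  also have "\<dots> \<le> 2 * real d * (ln (real T) + ln (1 + real T / (1 / C\<^sup>2)))"
  proof (rule sum_min_leverage_le)
    show "ip d (masked q x s) (masked q x s) \<le> 1" if "s < T" for s
      using x(1)[OF that] by (cases "q s") (auto simp: ip_def masked_def)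
  qed (use C dT T in auto)
  also have "\<dots> \<le> 2 * real d * (2 * (1 + ln (real T) + ln (1 + C)))"
  proof (rule mult_left_mono)
    \<comment> \<open>This separates the logarithm into ln T + 2 ln (1 + C);
      \<open>T \<ge> 1\<close> absorbs the leading 1.\<close>
    have "1 + real T / (1 / C\<^sup>2) \<le> real T * (1 + C)\<^sup>2"
    proof -
      have "1 + real T * C\<^sup>2 \<le> real T + real T * C\<^sup>2 + 2 * real T * C"
      proof -
        have "1 \<le> real T" "0 \<le> 2 * real T * C" using T C by auto
        then show ?thesis by linarith
      qed
      then show ?thesis by (simp add: power2_eq_square algebra_simps)
    qed
    then have "ln (1 + real T / (1 / C\<^sup>2)) \<le> ln (real T * (1 + C)\<^sup>2)"
      using C T by (intro ln_mono) (auto intro!: add_pos_nonneg)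
    also have "\<dots> = ln (real T) + 2 * ln (1 + C)"
      using C T by (subst ln_mult_pos) (auto simp: ln_realpow)
    finally show "ln (real T) + ln (1 + real T / (1 / C\<^sup>2)) \<le> 2 * (1 + ln (real T) + ln (1 + C))"
      by simp
  qed simp
  also have "\<dots> = 4 * real d * (1 + ln (real T) + ln (1 + C))" by simp
  finally show ?thesis .
qed

lemma integral_query_sq_error:
  "t < T \<Longrightarrow> (\<integral>\<omega>. of_bool (fst (\<omega> t)) * sq_error t \<omega> \<partial>\<Omega>) = \<mu> * (\<integral>\<omega>. sq_error t \<omega> \<partial>\<Omega>)"
  by (rule integral_query_mult[where B=4])
     (auto intro: abs_sq_error_le simp: sq_error_upd)

text \<open>Splitting over patterns and exchanging the sums leaves, for each fixed pattern, the
  deterministic potential bound. The pattern probabilities sum to 1, and the constant is 8 times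
  4.\<close>

lemma queried_error_le:
  assumes dT: "d \<le> T" and T: "T \<ge> 1"
  shows "(\<Sum>t<T. \<integral>\<omega>. of_bool (fst (\<omega> t)) * sq_error t \<omega> \<partial>\<Omega>)
    \<le> 32 * (max 1 \<eta>)\<^sup>2 * real d * (1 + ln (real T) + ln (1 + C))"
proof -
  have int: "integrable \<Omega> (\<lambda>\<omega>. pattern q \<omega> * sq_error t \<omega>)" if t: "t < T" for q t
  proof -
    have [measurable]: "pattern q \<in> borel_measurable \<Omega>"
      using pattern_integral(1) by (rule borel_measurable_integrable)
    show ?thesis using t sq_error_bounds[of t]
      by (intro bounded_integrable[where B=4]) (auto simp: pattern_eq)
  qed
  have "(\<integral>\<omega>. of_bool (fst (\<omega> t)) * sq_error t \<omega> \<partial>\<Omega>)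
      = (\<Sum>q\<in>patterns. of_bool (q t) * (\<integral>\<omega>. pattern q \<omega> * sq_error t \<omega> \<partial>\<Omega>))" if t: "t < T" for t
  proof -
    have "of_bool (fst (\<omega> t)) * sq_error t \<omega>
        = (\<Sum>q\<in>patterns. of_bool (q t) * (pattern q \<omega> * sq_error t \<omega>))" for \<omega>
    proof -
      have "of_bool (fst (\<omega> t)) * sq_error t \<omega>
          = (\<Sum>q\<in>patterns. pattern q \<omega>) * (of_bool (fst (\<omega> t)) * sq_error t \<omega>)"
        by (simp only: sum_pattern mult_1)
      also have "\<dots> = (\<Sum>q\<in>patterns. of_bool (q t) * (pattern q \<omega> * sq_error t \<omega>))"
        unfolding sum_distrib_right by (rule sum.cong) (use t in \<open>auto simp: pattern_eq\<close>)
      finally show ?thesis .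
    qed
    then show ?thesis using int[OF t] by (simp add: Bochner_Integration.integral_sum)
  qed
  then have "(\<Sum>t<T. \<integral>\<omega>. of_bool (fst (\<omega> t)) * sq_error t \<omega> \<partial>\<Omega>)
      = (\<Sum>t<T. \<Sum>q\<in>patterns. of_bool (q t) * (\<integral>\<omega>. pattern q \<omega> * sq_error t \<omega> \<partial>\<Omega>))"
    by (intro sum.cong) auto
  also have "\<dots> \<le> (\<Sum>t<T. \<Sum>q\<in>patterns. of_bool (q t) * (pattern_prob q * (8 * (max 1 \<eta>)\<^sup>2 * min 1 (lev q t))))"
    by (intro sum_mono mult_left_mono pattern_integral_sq_error) auto
  also have "\<dots> = (\<Sum>q\<in>patterns. \<Sum>t<T. of_bool (q t) * (pattern_prob q * (8 * (max 1 \<eta>)\<^sup>2 * min 1 (lev q t))))"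
    by (rule sum.swap)
  also have "\<dots> = (\<Sum>q\<in>patterns. pattern_prob q * (8 * (max 1 \<eta>)\<^sup>2 * (\<Sum>t<T. of_bool (q t) * min 1 (lev q t))))"
    unfolding sum_distrib_left by (intro sum.cong refl) (simp only: mult_ac)
  also have "\<dots> \<le> (\<Sum>q\<in>patterns. pattern_prob q * (8 * (max 1 \<eta>)\<^sup>2 * (4 * real d * (1 + ln (real T) + ln (1 + C)))))"
    by (intro sum_mono mult_left_mono pattern_prob_nonneg sum_min_lev_le dT T) auto
  also have "\<dots> = 8 * (max 1 \<eta>)\<^sup>2 * (4 * real d * (1 + ln (real T) + ln (1 + C)))"
    unfolding sum_distrib_right[symmetric] sum_pattern_prob by simp
  finally show ?thesis by simp
qed

section \<open>Expected query count and the final bound\<close>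

lemma integral_num_queries: "(\<integral>\<omega>. num_queries T \<omega> \<partial>\<Omega>) = \<mu> * real T"
proof -
  have q: "(\<integral>\<omega>. of_bool (fst (\<omega> t)) \<partial>\<Omega>) = \<mu>" if "t < T" for t
    using integral_query_mult[OF that, of "\<lambda>_. 1" 1] by (simp add: \<Omega>.prob_space)
  have i: "integrable \<Omega> (\<lambda>\<omega>. of_bool (fst (\<omega> t)) :: real)" if "t < T" for t
    by (rule bounded_integrable[where B=1]) (use that in \<open>auto simp: of_bool_def\<close>)
  have "(\<integral>\<omega>. num_queries T \<omega> \<partial>\<Omega>) = (\<integral>\<omega>. (\<Sum>t<T. of_bool (fst (\<omega> t))) \<partial>\<Omega>)"
    by (simp add: num_queries_def[abs_def] of_bool_def)
  also have "\<dots> = (\<Sum>t<T. \<mu>)"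
    by (subst Bochner_Integration.integral_sum) (use q i in auto)
  finally show ?thesis by simp
qed

lemma regret_eq: "regret d T C \<theta>s x = (\<lambda>\<omega>. \<Sum>t<T. sq_error t \<omega>)"
  by (simp add: regret_def sq_error_def fun_eq_iff)

lemma integrable_regret: "integrable \<Omega> (regret d T C \<theta>s x)"
  unfolding regret_eq by (intro Bochner_Integration.integrable_sum integrable_sq_error) simp

lemma integral_regret_le:
  assumes T: "T \<ge> 1"
  shows "(\<integral>\<omega>. regret d T C \<theta>s x \<omega> \<partial>\<Omega>)
    \<le> 32 * (max 1 \<eta>)\<^sup>2 * real d / \<mu> * (1 + ln (real T) + ln (1 + C))"
proof -
  have R: "(\<integral>\<omega>. regret d T C \<theta>s x \<omega> \<partial>\<Omega>) = (\<Sum>t<T. \<integral>\<omega>. sq_error t \<omega> \<partial>\<Omega>)"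
    unfolding regret_eq by (intro Bochner_Integration.integral_sum integrable_sq_error) simp
  show ?thesis
  proof (cases "d \<le> T")
    case True
    have "\<mu> * (\<integral>\<omega>. regret d T C \<theta>s x \<omega> \<partial>\<Omega>) = (\<Sum>t<T. \<integral>\<omega>. of_bool (fst (\<omega> t)) * sq_error t \<omega> \<partial>\<Omega>)"
      unfolding R sum_distrib_left by (intro sum.cong) (auto simp: integral_query_sq_error)
    also have "\<dots> \<le> 32 * (max 1 \<eta>)\<^sup>2 * real d * (1 + ln (real T) + ln (1 + C))"
      by (rule queried_error_le[OF True T])
    finally show ?thesis using \<mu> by (simp add: field_simps)
  next
    case False
    have "(\<integral>\<omega>. sq_error t \<omega> \<partial>\<Omega>) \<le> 4" if "t < T" for t
      using \<Omega>.integral_le_const[OF integrable_sq_error[OF that], of 4] sq_error_bounds(2)[OF that] by simp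
    then have "(\<integral>\<omega>. regret d T C \<theta>s x \<omega> \<partial>\<Omega>) \<le> (\<Sum>t<T. 4)"
      unfolding R by (intro sum_mono) auto
    \<comment> \<open>Here \<open>d\<close> exceeds \<open>T\<close>, so the trivial bound 4T is
      already below 32d, and the factors introduced next are all at least 1.\<close>
    also have "\<dots> \<le> 32 * 1 * real d / 1 * 1" using False by simp
    also have "\<dots> \<le> 32 * (max 1 \<eta>)\<^sup>2 * real d / \<mu> * (1 + ln (real T) + ln (1 + C))"
      using \<mu> C T by (intro mult_mono frac_le) auto
    finally show ?thesis .
  qed
qed

end

text \<open>The point mass at 0 serves as noise law for rounds from \<open>T\<close> on.\<close>

lemma subgaussian_return_0: "subgaussian (return borel 0) \<eta>"
proof -
  interpret prob_space "return borel (0 :: real)" by (rule prob_space_return) simp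
  have int: "integrable (return borel 0) f" if f: "f \<in> borel_measurable borel" for f :: "real \<Rightarrow> real"
  proof (rule integrable_const_bound)
    have "Measurable.pred borel (\<lambda>z. norm (f z) \<le> \<bar>f 0\<bar>)" using f by measurable
    then show "AE z in return borel 0. norm (f z) \<le> \<bar>f 0\<bar>" by (subst AE_return) auto
  qed (use f in simp)
  show ?thesis
    unfolding subgaussian_def
    by (intro conjI allI int prob_space_axioms) (auto simp: integral_return)
qed

theorem mainTheorem11:
  shows "\<exists>K>0. \<exists>k::nat. \<forall>(d::nat) (T::nat) (C::real) (\<eta>::real) (\<mu>::real) \<theta>s x N.
     d \<ge> 1 \<longrightarrow> T \<ge> 1 \<longrightarrow> C > 0 \<longrightarrow> \<eta> \<ge> 0 \<longrightarrow> 0 < \<mu> \<longrightarrow> \<mu> \<le> 1 \<longrightarrow>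
     \<theta>s \<in> Vd d \<longrightarrow> ip d \<theta>s \<theta>s \<le> C\<^sup>2 \<longrightarrow>
     (\<forall>t<T. x t \<in> Vd d \<and> ip d (x t) (x t) \<le> 1 \<and> \<bar>ip d \<theta>s (x t)\<bar> \<le> 1) \<longrightarrow>
     (\<forall>t<T. subgaussian (N t) \<eta>) \<longrightarrow>
     ((\<integral>\<omega>. num_queries T \<omega> \<partial>outcome_space T \<mu> N) = \<mu> * real T \<and>
      integrable (outcome_space T \<mu> N) (regret d T C \<theta>s x) \<and>
      (\<integral>\<omega>. regret d T C \<theta>s x \<omega> \<partial>outcome_space T \<mu> N)
        \<le> K * (max 1 \<eta>)\<^sup>2 * real d / \<mu> * (1 + ln (real T) + ln (1 + C)) ^ k)"
proof (rule exI[of _ 32], rule conjI[OF zero_less_numeral], rule exI[of _ 1], intro allI impI, goal_cases)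
  case (1 d T C \<eta> \<mu> \<theta>s x N)
  \<comment> \<open>N is unconstrained at rounds \<open>\<ge> T\<close>, which the outcome space ignores.\<close>
  define N' where "N' t = (if t < T then N t else return borel 0)" for t
  have eq: "outcome_space T \<mu> N = outcome_space T \<mu> N'"
    unfolding outcome_space_def by (rule PiM_cong) (auto simp: N'_def)
  interpret oblivious_regression T \<mu> \<eta> N' d C \<theta>s x
    by unfold_locales (use 1 subgaussian_return_0 in \<open>auto simp: N'_def\<close>)
  \<comment> \<open>The witnesses are \<open>K = 32\<close> and \<open>k = 1\<close>: a single
    logarithmic factor suffices.\<close>
  show ?case
    unfolding eq power_one_right using integral_num_queries integrable_regret integral_regret_le 1(2) by blast
qed

end
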